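(* For every even integer $n \geq 12$, $r^{*}(P_3, C_n) \leq 2n-2$.
   Context: All graphs are finite and simple. $P_3$ is the path on $3$ vertices and $C_n$ is the cycle on $n$ vertices. For graphs $F,G,H$, we write $F \rightarrow (G,H)$ if for every $2$-coloring of the edges of $F$ with colors red and blue there is a red copy of $G$ or a blue copy of $H$ in $F$ (as subgraphs). The Ramsey number is $r(G,H)=\min\{|V(F)| : F \rightarrow (G,H)\}$, and the restricted size Ramsey number is $r^{*}(G,H)=\min\{|E(F)| : F \rightarrow (G,H),\ |V(F)|=r(G,H)\}$. *)

theory Defs
  imports Main "HOL-Library.Ramsey"
begin

record 'a graph =
  verts :: "'a set"
  edges :: "'a set set"

definition fin_simple_graph :: "'a graph \<Rightarrow> bool" where
  "fin_simple_graph F \<longleftrightarrow> finite (verts F) \<and> edges F \<subseteq> nsets (verts F) 2"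

definition path_graph :: "nat \<Rightarrow> nat graph" where
  "path_graph m = \<lparr>verts = {..<m}, edges = {{i, Suc i} | i. Suc i < m}\<rparr>"

text \<open>This is the cycle on n vertices only for n at least 3.\<close>

definition cycle_graph :: "nat \<Rightarrow> nat graph" where
  "cycle_graph n = \<lparr>verts = {..<n}, edges = {{i, Suc i mod n} | i. i < n}\<rparr>"

text \<open>Copies are subgraphs, not necessarily induced.\<close>

definition contains_copy :: "'a graph \<Rightarrow> 'b graph \<Rightarrow> bool" where
  "contains_copy F G \<longleftrightarrow>
     (\<exists>f. inj_on f (verts G) \<and> f ` verts G \<subseteq> verts F \<and> (\<forall>e \<in> edges G. f ` e \<in> edges F))"

datatype colour = Red | Blue

definition colour_class :: "'a graph \<Rightarrow> ('a set \<Rightarrow> colour) \<Rightarrow> colour \<Rightarrow> 'a graph" where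
  "colour_class F c k = \<lparr>verts = verts F, edges = {e \<in> edges F. c e = k}\<rparr>"

definition arrows :: "'a graph \<Rightarrow> 'b graph \<Rightarrow> 'c graph \<Rightarrow> bool" where
  "arrows F G H \<longleftrightarrow>
     (\<forall>c. contains_copy (colour_class F c Red) G \<or> contains_copy (colour_class F c Blue) H)"

text \<open>Every finite graph is isomorphic to one with vertices in \<^typ>\<open>nat\<close>, so the host
  graphs \<open>F\<close> may be taken there. A \<open>LEAST\<close> over an empty set of values is unspecified, so no
  bound holds by default.\<close>

definition ramsey_number :: "'b graph \<Rightarrow> 'c graph \<Rightarrow> nat" where
  "ramsey_number G H =
     (LEAST k. \<exists>F :: nat graph. fin_simple_graph F \<and> arrows F G H \<and> card (verts F) = k)"

definition restricted_size_ramsey_number :: "'b graph \<Rightarrow> 'c graph \<Rightarrow> nat" where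
  "restricted_size_ramsey_number G H =
     (LEAST m. \<exists>F :: nat graph. fin_simple_graph F \<and> arrows F G H \<and>
        card (verts F) = ramsey_number G H \<and> card (edges F) = m)"

end

theory Submission imports Defs begin

text \<open>
  The host graph consists of two caps joined by a ladder. A cap is a graph on seven vertices with
  eleven edges and two terminals that keeps a Hamiltonian path between its terminals after the
  deletion of any matching. The ladder is a sequence of pairs of vertices, consecutive pairs being
  joined by a \<open>K\<^sub>2\<^sub>,\<^sub>2\<close>; deleting a matching from \<open>K\<^sub>2\<^sub>,\<^sub>2\<close> leaves one of its two perfect matchings.
  If there is no red \<open>P\<^sub>3\<close>, the red edges are a matching. A blue Hamiltonian path between the
  terminals of the left cap can then be prolonged at both ends through the ladder, pair by pair,
  and finally closed by a blue Hamiltonian path of the right cap. With \<open>k\<close> copies of \<open>K\<^sub>2\<^sub>,\<^sub>2\<close> there are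
  \<open>n = 2k + 12\<close> vertices and \<open>4k + 22 = 2n - 2\<close> edges.
\<close>

section \<open>Walks as vertex lists, and complements of matchings\<close>

abbreviation walk :: "'a set set \<Rightarrow> 'a list \<Rightarrow> bool" where
  "walk B \<equiv> successively (\<lambda>u v. {u, v} \<in> B)"

lemma walk_rev: "walk B (rev xs) \<longleftrightarrow> walk B xs"
  by (simp add: successively_rev insert_commute)

lemma walk_extend:
  assumes "walk B xs" "xs \<noteq> []" "{u, hd xs} \<in> B" "{last xs, v} \<in> B"
  shows "walk B (u # xs @ [v])"
  using assms by (auto simp: successively_append_iff successively_Cons)

text \<open>Here and below \<open>B\<close> plays the role of the blue edges, and
  \<open>pairwise disjnt (E - B)\<close> says that the red ones form a matching.\<close>

lemma meeting_edge_in_complement_of_matching: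
  assumes "pairwise disjnt (E - B)" "e \<in> E" "f \<in> E" "e \<noteq> f" "e \<inter> f \<noteq> {}"
  shows "e \<in> B \<or> f \<in> B"
  using assms unfolding pairwise_def disjnt_def by blast

section \<open>The cap and its Hamiltonian paths\<close>

definition cap_edges :: "'a \<Rightarrow> 'a \<Rightarrow> 'a \<Rightarrow> 'a \<Rightarrow> 'a \<Rightarrow> 'a \<Rightarrow> 'a \<Rightarrow> 'a set set" where
  "cap_edges x y a b c d e =
     set [{x, a}, {x, d}, {x, e}, {y, d}, {y, e}, {a, b}, {a, c}, {b, d}, {b, e}, {c, d}, {c, e}]"

text \<open>The edges between \<open>{d, e}\<close> and \<open>{b, c, y}\<close> form a
  \<open>K\<^sub>2\<^sub>,\<^sub>3\<close>, from which a matching removes at most one edge at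
  \<open>d\<close> and one at \<open>e\<close>. Losing \<open>{b, d}\<close> and
  \<open>{c, e}\<close> destroys every path that starts with \<open>{x, a}\<close>; the edges from
  \<open>x\<close> to \<open>d\<close> and \<open>e\<close> then provide a path that has
  \<open>a\<close> in the middle.\<close>

lemma cap_hamiltonian_path:
  assumes dist: "distinct [x, y, a, b, c, d, e]"
    and sub: "cap_edges x y a b c d e \<subseteq> E"
    and matching: "pairwise disjnt (E - B)"
  obtains zs where "distinct zs" "set zs = {a, b, c, d, e}" "walk B (x # zs @ [y])"
proof -
  note meet = meeting_edge_in_complement_of_matching[OF matching]
  have E: "{x, a} \<in> E" "{x, d} \<in> E" "{x, e} \<in> E" "{y, d} \<in> E" "{y, e} \<in> E" "{a, b} \<in> E"
      "{a, c} \<in> E" "{b, d} \<in> E" "{b, e} \<in> E" "{c, d} \<in> E" "{c, e} \<in> E"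
    using sub by (auto simp: cap_edges_def)
  \<comment> \<open>One clause for each of the 25 pairs of meeting cap edges: together they express
    the matching condition on the cap, and the rest is propositional.\<close>
  have "{x, a} \<in> B \<or> {x, d} \<in> B" "{x, a} \<in> B \<or> {x, e} \<in> B" "{x, a} \<in> B \<or> {a, b} \<in> B"
      "{x, a} \<in> B \<or> {a, c} \<in> B" "{x, d} \<in> B \<or> {x, e} \<in> B" "{x, d} \<in> B \<or> {y, d} \<in> B"
      "{x, d} \<in> B \<or> {b, d} \<in> B" "{x, d} \<in> B \<or> {c, d} \<in> B" "{x, e} \<in> B \<or> {y, e} \<in> B"
      "{x, e} \<in> B \<or> {b, e} \<in> B" "{x, e} \<in> B \<or> {c, e} \<in> B" "{y, d} \<in> B \<or> {y, e} \<in> B"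
      "{y, d} \<in> B \<or> {b, d} \<in> B" "{y, d} \<in> B \<or> {c, d} \<in> B" "{y, e} \<in> B \<or> {b, e} \<in> B"
      "{y, e} \<in> B \<or> {c, e} \<in> B" "{a, b} \<in> B \<or> {a, c} \<in> B" "{a, b} \<in> B \<or> {b, d} \<in> B"
      "{a, b} \<in> B \<or> {b, e} \<in> B" "{a, c} \<in> B \<or> {c, d} \<in> B" "{a, c} \<in> B \<or> {c, e} \<in> B"
      "{b, d} \<in> B \<or> {b, e} \<in> B" "{b, d} \<in> B \<or> {c, d} \<in> B" "{b, e} \<in> B \<or> {c, e} \<in> B"
      "{c, d} \<in> B \<or> {c, e} \<in> B"
    by (rule meet; use E dist in \<open>auto simp: doubleton_eq_iff\<close>)+
  \<comment> \<open>These eight lists give all Hamiltonian paths of the cap from \<open>x\<close> to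
    \<open>y\<close>.\<close>
  then have "\<exists>zs \<in> set [[a, b, d, c, e], [a, b, e, c, d], [a, c, d, b, e], [a, c, e, b, d],
      [d, b, a, c, e], [d, c, a, b, e], [e, b, a, c, d], [e, c, a, b, d]]. walk B (x # zs @ [y])"
    by (simp add: insert_commute) sat
  then obtain zs where "walk B (x # zs @ [y])" and zs: "zs \<in> set [[a, b, d, c, e], [a, b, e, c, d],
      [a, c, d, b, e], [a, c, e, b, d], [d, b, a, c, e], [d, c, a, b, e], [e, b, a, c, d],
      [e, c, a, b, d]]"
    by blast
  moreover have "distinct zs" "set zs = {a, b, c, d, e}"
    using zs dist by auto
  ultimately show thesis
    using that by blast
qed

section \<open>The capped ladder\<close>

definition rung_edges :: "nat \<Rightarrow> nat set set" where
  "rung_edges i =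
     set [{2*i + 5, 2*i + 7}, {2*i + 5, 2*i + 8}, {2*i + 6, 2*i + 7}, {2*i + 6, 2*i + 8}]"

text \<open>The left cap has interior 0 to 4, the pairs are \<open>2*i + 5\<close>,
  \<open>2*i + 6\<close> for \<open>i \<le> k\<close>, and the last five vertices are the interior
  of the right cap. For \<open>k = 0\<close> the caps share both terminals.\<close>

definition capped_ladder :: "nat \<Rightarrow> nat graph" where
  "capped_ladder k = \<lparr>verts = {..<2*k + 12},
     edges = cap_edges 5 6 0 1 2 3 4 \<union> (\<Union>i<k. rung_edges i) \<union>
       cap_edges (2*k + 5) (2*k + 6) (2*k + 7) (2*k + 8) (2*k + 9) (2*k + 10) (2*k + 11)\<rparr>"

lemma fin_simple_capped_ladder: "fin_simple_graph (capped_ladder k)"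
  by (auto simp: fin_simple_graph_def capped_ladder_def cap_edges_def rung_edges_def
      nsets_def card_insert_if)

lemma card_edges_capped_ladder: "card (edges (capped_ladder k)) \<le> 4*k + 22"
proof -
  have cap: "card (cap_edges x y a b c d e) \<le> 11" for x y a b c d e :: nat
    unfolding cap_edges_def by (rule order.trans[OF card_length]) simp
  have "card (\<Union>i<k. rung_edges i) \<le> (\<Sum>i<k. card (rung_edges i))"
    by (rule card_UN_le) simp
  also have "\<dots> \<le> (\<Sum>i<k. 4)"
    unfolding rung_edges_def by (intro sum_mono order.trans[OF card_length]) simp
  finally have rungs: "card (\<Union>i<k. rung_edges i) \<le> 4*k"
    by simp
  have "card (edges (capped_ladder k)) \<le> 11 + 4*k + 11"
    unfolding capped_ladder_def graph.simps
    by (rule order.trans[OF card_Un_le] add_mono cap rungs)+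
  then show ?thesis by simp
qed

text \<open>Induction on the pair reached. The numbering makes the vertices up to pair
  \<open>i\<close> an initial segment, and \<open>i = k\<close> ends at the terminals of the right
  cap.\<close>

lemma ladder_hamiltonian_path:
  assumes matching: "pairwise disjnt (edges (capped_ladder k) - B)" and "i \<le> k"
  shows "\<exists>zs. distinct ((2*i + 5) # zs @ [2*i + 6]) \<and>
    set ((2*i + 5) # zs @ [2*i + 6]) = {..<2*i + 7} \<and> walk B ((2*i + 5) # zs @ [2*i + 6])"
  using \<open>i \<le> k\<close>
proof (induction i)
  case 0
  obtain zs where zs: "distinct zs" "set zs = {0::nat, 1, 2, 3, 4}" "walk B (5 # zs @ [6])"
  proof (rule cap_hamiltonian_path[OF _ _ matching])
    show "cap_edges 5 6 0 1 2 3 4 \<subseteq> edges (capped_ladder k)"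
      by (auto simp: capped_ladder_def)
  qed auto
  have "{..<7} = {0::nat, 1, 2, 3, 4, 5, 6}"
    by auto
  with zs show ?case
    by (intro exI[of _ zs]) auto
next
  case (Suc i)
  define x y x' y' where "x = 2*i + 5" and "y = 2*i + 6" and "x' = 2*i + 7" and "y' = 2*i + 8"
  note defs = x_def y_def x'_def y'_def
  obtain zs where zs: "distinct (x # zs @ [y])" "set (x # zs @ [y]) = {..<x'}"
      "walk B (x # zs @ [y])"
    using Suc by (auto simp: defs)
  have next_pair: "2 * Suc i + 5 = x'" "2 * Suc i + 6 = y'"
      "{..<2 * Suc i + 7} = {..<x'} \<union> {x', y'}"
    by (auto simp: defs)
  have "rung_edges i \<subseteq> edges (capped_ladder k)"
    using Suc.prems by (auto simp: capped_ladder_def)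
  then have E: "{x, x'} \<in> edges (capped_ladder k)" "{x, y'} \<in> edges (capped_ladder k)"
      "{y, x'} \<in> edges (capped_ladder k)" "{y, y'} \<in> edges (capped_ladder k)"
    by (simp_all add: rung_edges_def defs)
  \<comment> \<open>By distributivity the four clauses say that one of the two perfect matchings of
    the \<open>K\<^sub>2\<^sub>,\<^sub>2\<close> lies in \<open>B\<close>.\<close>
  have "{x, x'} \<in> B \<or> {x, y'} \<in> B" "{x, x'} \<in> B \<or> {y, x'} \<in> B"
      "{y, y'} \<in> B \<or> {x, y'} \<in> B" "{y, y'} \<in> B \<or> {y, x'} \<in> B"
    by (rule meeting_edge_in_complement_of_matching[OF matching];
        use E in \<open>auto simp: doubleton_eq_iff defs\<close>)+
  then consider "{x', x} \<in> B" "{y, y'} \<in> B" | "{x', y} \<in> B" "{x, y'} \<in> B"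
    by (auto simp: insert_commute)
  then have "\<exists>ws. distinct ws \<and> set ws = {..<x'} \<and> walk B (x' # ws @ [y'])"
  proof cases
    case 1
    then have "walk B (x' # (x # zs @ [y]) @ [y'])"
      by (intro walk_extend zs(3)) simp_all
    with zs(1,2) show ?thesis
      by blast
  next
    case 2
    \<comment> \<open>The crossing matching joins \<open>x'\<close> to \<open>y\<close>, so the old
      path is run backwards.\<close>
    then have "walk B (x' # rev (x # zs @ [y]) @ [y'])"
      by (intro walk_extend walk_rev[THEN iffD2] zs(3)) simp_all
    moreover have "distinct (rev (x # zs @ [y]))" "set (rev (x # zs @ [y])) = {..<x'}"
      using zs(1,2) by (simp_all only: distinct_rev set_rev)
    ultimately show ?thesis
      by blast
  qed
  then obtain ws where ws: "distinct ws" "set ws = {..<x'}" "walk B (x' # ws @ [y'])"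
    by blast
  then show ?case
    unfolding next_pair by (intro exI[of _ ws]) (auto simp: x'_def y'_def)
qed

section \<open>Copies of the cycle and of the path on three vertices\<close>

lemma contains_cycle_if_closed_walk:
  assumes "distinct xs" "set xs \<subseteq> verts F" "length xs = n" "xs \<noteq> []"
    and walk: "walk (edges F) xs" and close: "{last xs, hd xs} \<in> edges F"
  shows "contains_copy F (cycle_graph n)"
  unfolding contains_copy_def
proof (intro exI[of _ "nth xs"] conjI ballI)
  show "inj_on ((!) xs) (verts (cycle_graph n))"
    using assms by (auto simp: cycle_graph_def inj_on_def nth_eq_iff_index_eq)
  show "(!) xs ` verts (cycle_graph n) \<subseteq> verts F"
    using assms by (auto simp: cycle_graph_def)
  fix e assume "e \<in> edges (cycle_graph n)"
  then obtain i where i: "i < n" "e = {i, Suc i mod n}"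
    by (auto simp: cycle_graph_def)
  show "(!) xs ` e \<in> edges F"
  proof (cases "Suc i < n")
    case True
    with walk i \<open>length xs = n\<close> show ?thesis
      by (auto simp: successively_conv_nth)
  next
    case False
    with i have "Suc i = n"
      by simp
    with i \<open>length xs = n\<close> have "i = length xs - 1" "e = {i, 0}"
      by auto
    with close \<open>xs \<noteq> []\<close> show ?thesis
      by (auto simp: last_conv_nth hd_conv_nth)
  qed
qed

lemma red_edges_matching_if_no_path3:
  assumes "fin_simple_graph F" "\<not> contains_copy (colour_class F c Red) (path_graph 3)"
  shows "pairwise disjnt (edges F - edges (colour_class F c Blue))"
proof (rule ccontr)
  assume "\<not> ?thesis"
  then obtain e f where "e \<in> edges F" "f \<in> edges F" "e \<noteq> f" "c e \<noteq> Blue" "c f \<noteq> Blue"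
      and "e \<inter> f \<noteq> {}"
    by (auto simp: pairwise_def disjnt_def colour_class_def)
  then obtain u where ef: "e \<in> edges F" "f \<in> edges F" "e \<noteq> f" "c e = Red" "c f = Red"
      and u: "u \<in> e" "u \<in> f"
    using colour.exhaust by blast
  have two: "\<exists>v. g = {u, v} \<and> u \<noteq> v \<and> u \<in> verts F \<and> v \<in> verts F" if "g \<in> edges F" "u \<in> g" for g
  proof -
    from that(1) assms(1) have "g \<subseteq> verts F" "card g = 2"
      by (auto simp: fin_simple_graph_def nsets_def)
    with that(2) show ?thesis
      by (auto simp: card_2_iff)
  qed
  obtain v where v: "e = {u, v}" "u \<noteq> v" "u \<in> verts F" "v \<in> verts F"
    using two[OF ef(1) u(1)] by blast
  obtain w where w: "f = {u, w}" "u \<noteq> w" "w \<in> verts F"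
    using two[OF ef(2) u(2)] by blast
  have "v \<noteq> w"
    using ef v w by auto
  have P: "verts (path_graph 3) = {0, 1, 2}" "edges (path_graph 3) = {{0, 1}, {1, 2}}"
    by (auto simp: path_graph_def less_Suc_eq numeral_3_eq_3 numeral_2_eq_2)
  \<comment> \<open>The common vertex \<open>u\<close> takes the middle position 1 of the
    path.\<close>
  have "contains_copy (colour_class F c Red) (path_graph 3)"
    unfolding contains_copy_def P
    using ef v w \<open>v \<noteq> w\<close>
    by (intro exI[of _ "(!) [v, u, w]"])
      (auto simp: inj_on_def colour_class_def insert_commute)
  with assms(2) show False ..
qed

lemma arrows_capped_ladder:
  "arrows (capped_ladder k) (path_graph 3) (cycle_graph (2*k + 12))"
  unfolding arrows_def
proof
  fix c
  let ?F = "capped_ladder k"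
  let ?B = "edges (colour_class ?F c Blue)"
  let ?x = "2*k + 5" and ?y = "2*k + 6"
  have "contains_copy (colour_class ?F c Blue) (cycle_graph (2*k + 12))"
    if "\<not> contains_copy (colour_class ?F c Red) (path_graph 3)"
  proof -
    from that have matching: "pairwise disjnt (edges ?F - ?B)"
      by (rule red_edges_matching_if_no_path3[OF fin_simple_capped_ladder])
    obtain zs where zs: "distinct (?x # zs @ [?y])" "set (?x # zs @ [?y]) = {..<2*k + 7}"
        "walk ?B (?x # zs @ [?y])"
      using ladder_hamiltonian_path[OF matching order.refl] by blast
    obtain ws where ws: "distinct ws" "set ws = {2*k + 7, 2*k + 8, 2*k + 9, 2*k + 10, 2*k + 11}"
        "walk ?B (?x # ws @ [?y])"
    proof (rule cap_hamiltonian_path[OF _ _ matching])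
      show "cap_edges ?x ?y (2*k + 7) (2*k + 8) (2*k + 9) (2*k + 10) (2*k + 11) \<subseteq> edges ?F"
        by (auto simp: capped_ladder_def)
    qed auto
    \<comment> \<open>From \<open>?x\<close> through the ladder and the left cap to
      \<open>?y\<close>, then back through the interior of the right cap; the edge from
      \<open>hd ws\<close> to \<open>?x\<close> closes the cycle.\<close>
    define xs where "xs = (?x # zs @ [?y]) @ rev ws"
    have "ws \<noteq> []"
      using ws(2) by auto
    have "walk ?B (rev (?x # ws @ [?y]))"
      using ws(3) by (simp only: walk_rev)
    then have closing: "walk ?B (?y # rev ws)" "{hd ws, ?x} \<in> ?B"
      using \<open>ws \<noteq> []\<close> by (auto simp: successively_append_iff successively_Cons last_rev)
    have set_xs: "set xs = {..<2*k + 12}"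
      unfolding xs_def set_append zs(2) set_rev ws(2) by auto
    have dist: "distinct xs"
      unfolding xs_def distinct_append zs(2) set_rev ws(2) using zs(1) ws(1) by auto
    show ?thesis
    proof (rule contains_cycle_if_closed_walk[OF dist])
      show "set xs \<subseteq> verts (colour_class ?F c Blue)"
        by (simp add: set_xs colour_class_def capped_ladder_def)
      show "length xs = 2*k + 12"
        using distinct_card[OF dist] by (simp add: set_xs)
      show "xs \<noteq> []"
        by (simp add: xs_def)
      show "walk ?B xs"
        using zs(3) closing(1) \<open>ws \<noteq> []\<close>
        by (auto simp: xs_def successively_append_iff successively_Cons hd_append)
      show "{last xs, hd xs} \<in> ?B"
        using closing(2) \<open>ws \<noteq> []\<close> by (simp add: xs_def last_rev)
    qed
  qed
  then show "contains_copy (colour_class ?F c Red) (path_graph 3) \<or>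
      contains_copy (colour_class ?F c Blue) (cycle_graph (2*k + 12))"
    by blast
qed

section \<open>The Ramsey number and its restricted size version\<close>

text \<open>Colouring every edge blue leaves no red path, so the cycle itself must fit into
  \<open>F\<close>.\<close>

lemma cycle_length_le_if_arrows:
  assumes "fin_simple_graph F" "arrows F (path_graph 3) (cycle_graph n)"
  shows "n \<le> card (verts F)"
proof -
  have "{0, Suc 0} \<in> edges (path_graph 3)"
    by (auto simp: path_graph_def)
  then have "\<not> contains_copy (colour_class F (\<lambda>_. Blue) Red) (path_graph 3)"
    by (auto simp: contains_copy_def colour_class_def)
  with assms(2) have "contains_copy (colour_class F (\<lambda>_. Blue) Blue) (cycle_graph n)"
    unfolding arrows_def by blast
  then obtain f where "inj_on f {..<n}" "f ` {..<n} \<subseteq> verts F"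
    by (auto simp: contains_copy_def colour_class_def cycle_graph_def)
  with assms(1) have "card {..<n} \<le> card (verts F)"
    by (intro card_inj_on_le[of f]) (auto simp: fin_simple_graph_def)
  then show ?thesis
    by simp
qed

text \<open>The exact value is what makes \<open>capped_ladder k\<close> an admissible host for the
  restricted size Ramsey number.\<close>

lemma ramsey_number_path3_cycle:
  "ramsey_number (path_graph 3) (cycle_graph (2*k + 12)) = 2*k + 12"
  unfolding ramsey_number_def
proof (rule Least_equality)
  show "\<exists>F::nat graph. fin_simple_graph F \<and> arrows F (path_graph 3) (cycle_graph (2*k + 12)) \<and>
      card (verts F) = 2*k + 12"
    using fin_simple_capped_ladder arrows_capped_ladder
    by (intro exI[of _ "capped_ladder k"]) (simp add: capped_ladder_def)
qed (use cycle_length_le_if_arrows in blast)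

theorem theorem6:
  fixes n :: nat
  assumes "even n" and "n \<ge> 12"
  shows "restricted_size_ramsey_number (path_graph 3) (cycle_graph n) \<le> 2 * n - 2"
proof -
  obtain k where n: "n = 2*k + 12"
  proof
    show "n = 2 * ((n - 12) div 2) + 12"
      using assms by auto
  qed
  have "card (verts (capped_ladder k)) = 2*k + 12"
    by (simp add: capped_ladder_def)
  then have "restricted_size_ramsey_number (path_graph 3) (cycle_graph n)
      \<le> card (edges (capped_ladder k))"
    unfolding restricted_size_ramsey_number_def n ramsey_number_path3_cycle
    using fin_simple_capped_ladder arrows_capped_ladder by (intro Least_le) blast
  also have "\<dots> \<le> 4*k + 22"
    by (rule card_edges_capped_ladder)
  finally show ?thesis
    by (simp add: n)
qed

end
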